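(* Let $G$ be a group, $R$ a $G$-graded commutative ring with identity, and $M$, $M'$ two graded $R$-modules. Let $\varphi:M\to M'$ be a graded epimorphism and $N$ a graded submodule of $M$ containing $\ker\varphi$. If $N$ is a graded primary-like submodule of $M$, then $\varphi(N)$ is a graded primary-like submodule of $M'$.
   Context: All rings are commutative with identity and all modules are unitary. $R=\bigoplus_{g\in G}R_g$ is $G$-graded with $R_gR_h\subseteq R_{gh}$; a graded $R$-module is $M=\bigoplus_{g\in G}M_g$ with $R_gM_h\subseteq M_{gh}$; $h(R)=\bigcup_g R_g$ and $h(M)=\bigcup_g M_g$. A submodule $N$ of $M$ is graded if $N=\bigoplus_{g}(N\cap M_g)$. $(N:_R M)=\{r\in R: rM\subseteq N\}$. A graded homomorphism $\varphi:M\to M'$ is an $R$-module homomorphism with $\varphi(M_g)\subseteq M'_g$ for all $g\in G$; a graded epimorphism is a surjective graded homomorphism. A proper graded submodule $P$ of $M$ is graded prime if whenever $r\in h(R)$, $m\in h(M)$ and $rm\in P$, then $r\in(P:_RM)$ or $m\in P$. The graded radical $\mathrm{Gr}_M(N)$ of a graded submodule $N$ is the intersection of all graded prime submodules of $M$ containing $N$, with $\mathrm{Gr}_M(N)=M$ if there are none. A proper graded submodule $N$ of $M$ is graded primary-like if whenever $r\in h(R)$ and $m\in h(M)$ with $rm\in N$, then either $r\in(N:_RM)$ or $m\in\mathrm{Gr}_M(N)$. *)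

theory Defs
  imports "HOL-Algebra.Algebra"
begin

text \<open>
  \<open>internal_direct_sum M I A N\<close>: the subset \<open>N\<close> of the abelian group \<open>M\<close> is the internal direct
  sum of the subgroups \<open>A i\<close>, i.e. summation is a bijection from the families of finite support
  onto \<open>N\<close>. The families are extensional functions on \<open>I\<close>, so that uniqueness of the components
  is not spoiled by values outside \<open>I\<close>.
\<close>

definition internal_direct_sum ::
  "('b, 'm) ring_scheme \<Rightarrow> 'i set \<Rightarrow> ('i \<Rightarrow> 'b set) \<Rightarrow> 'b set \<Rightarrow> bool"
  where "internal_direct_sum M I A N \<longleftrightarrow>
    (\<forall>i\<in>I. additive_subgroup (A i) M) \<and>
    bij_betw (\<lambda>f. \<Oplus>\<^bsub>M\<^esub>i\<in>{i \<in> I. f i \<noteq> \<zero>\<^bsub>M\<^esub>}. f i)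
      {f \<in> \<Pi>\<^sub>E i\<in>I. A i. finite {i \<in> I. f i \<noteq> \<zero>\<^bsub>M\<^esub>}} N"

locale graded_cring = group G + cring R
  for G :: "('g, 'k) monoid_scheme" and R :: "('a, 'r) ring_scheme" +
  fixes Rg :: "'g \<Rightarrow> 'a set"
  assumes ring_decomposition: "internal_direct_sum R (carrier G) Rg (carrier R)"
    and ring_mult_degree:
      "\<lbrakk>g \<in> carrier G; h \<in> carrier G; r \<in> Rg g; s \<in> Rg h\<rbrakk>
        \<Longrightarrow> r \<otimes>\<^bsub>R\<^esub> s \<in> Rg (g \<otimes>\<^bsub>G\<^esub> h)"

locale graded_module = graded_cring G R Rg + module R M
  for G :: "('g, 'k) monoid_scheme" and R :: "('a, 'r) ring_scheme" and Rg :: "'g \<Rightarrow> 'a set"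
    and M :: "('a, 'b, 'm) module_scheme" +
  fixes Mg :: "'g \<Rightarrow> 'b set"
  assumes module_decomposition: "internal_direct_sum M (carrier G) Mg (carrier M)"
    and smult_degree:
      "\<lbrakk>g \<in> carrier G; h \<in> carrier G; r \<in> Rg g; m \<in> Mg h\<rbrakk>
        \<Longrightarrow> r \<odot>\<^bsub>M\<^esub> m \<in> Mg (g \<otimes>\<^bsub>G\<^esub> h)"

definition homogeneous :: "('g, 'k) monoid_scheme \<Rightarrow> ('g \<Rightarrow> 'b set) \<Rightarrow> 'b set"
  where "homogeneous G A = (\<Union>g\<in>carrier G. A g)"

definition graded_submodule ::
  "('g, 'k) monoid_scheme \<Rightarrow> ('a, 'r) ring_scheme \<Rightarrow> ('a, 'b, 'm) module_scheme
    \<Rightarrow> ('g \<Rightarrow> 'b set) \<Rightarrow> 'b set \<Rightarrow> bool"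
  where "graded_submodule G R M Mg N \<longleftrightarrow>
    submodule N R M \<and> internal_direct_sum M (carrier G) (\<lambda>g. N \<inter> Mg g) N"

definition residual ::
  "('a, 'r) ring_scheme \<Rightarrow> ('a, 'b, 'm) module_scheme \<Rightarrow> 'b set \<Rightarrow> 'a set"
  where "residual R M N = {r \<in> carrier R. \<forall>m\<in>carrier M. r \<odot>\<^bsub>M\<^esub> m \<in> N}"

definition graded_prime_submodule ::
  "('g, 'k) monoid_scheme \<Rightarrow> ('a, 'r) ring_scheme \<Rightarrow> ('g \<Rightarrow> 'a set)
    \<Rightarrow> ('a, 'b, 'm) module_scheme \<Rightarrow> ('g \<Rightarrow> 'b set) \<Rightarrow> 'b set \<Rightarrow> bool"
  where "graded_prime_submodule G R Rg M Mg P \<longleftrightarrow>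
    graded_submodule G R M Mg P \<and> P \<noteq> carrier M \<and>
    (\<forall>r\<in>homogeneous G Rg. \<forall>m\<in>homogeneous G Mg.
      r \<odot>\<^bsub>M\<^esub> m \<in> P \<longrightarrow> r \<in> residual R M P \<or> m \<in> P)"

definition graded_radical ::
  "('g, 'k) monoid_scheme \<Rightarrow> ('a, 'r) ring_scheme \<Rightarrow> ('g \<Rightarrow> 'a set)
    \<Rightarrow> ('a, 'b, 'm) module_scheme \<Rightarrow> ('g \<Rightarrow> 'b set) \<Rightarrow> 'b set \<Rightarrow> 'b set"
  where "graded_radical G R Rg M Mg N =
    (if \<exists>P. graded_prime_submodule G R Rg M Mg P \<and> N \<subseteq> P
     then \<Inter>{P. graded_prime_submodule G R Rg M Mg P \<and> N \<subseteq> P}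
     else carrier M)"

definition graded_primary_like_submodule ::
  "('g, 'k) monoid_scheme \<Rightarrow> ('a, 'r) ring_scheme \<Rightarrow> ('g \<Rightarrow> 'a set)
    \<Rightarrow> ('a, 'b, 'm) module_scheme \<Rightarrow> ('g \<Rightarrow> 'b set) \<Rightarrow> 'b set \<Rightarrow> bool"
  where "graded_primary_like_submodule G R Rg M Mg N \<longleftrightarrow>
    graded_submodule G R M Mg N \<and> N \<noteq> carrier M \<and>
    (\<forall>r\<in>homogeneous G Rg. \<forall>m\<in>homogeneous G Mg.
      r \<odot>\<^bsub>M\<^esub> m \<in> N \<longrightarrow> r \<in> residual R M N \<or> m \<in> graded_radical G R Rg M Mg N)"

definition graded_module_hom ::
  "('g, 'k) monoid_scheme \<Rightarrow> ('a, 'r) ring_scheme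
    \<Rightarrow> ('a, 'b, 'm) module_scheme \<Rightarrow> ('g \<Rightarrow> 'b set)
    \<Rightarrow> ('a, 'c, 'n) module_scheme \<Rightarrow> ('g \<Rightarrow> 'c set) \<Rightarrow> ('b \<Rightarrow> 'c) set"
  where "graded_module_hom G R M Mg M' Mg' =
    {\<phi> \<in> hom (add_monoid M) (add_monoid M').
      (\<forall>r\<in>carrier R. \<forall>m\<in>carrier M. \<phi> (r \<odot>\<^bsub>M\<^esub> m) = r \<odot>\<^bsub>M'\<^esub> \<phi> m) \<and>
      (\<forall>g\<in>carrier G. \<phi> ` Mg g \<subseteq> Mg' g)}"

definition graded_module_epi ::
  "('g, 'k) monoid_scheme \<Rightarrow> ('a, 'r) ring_scheme
    \<Rightarrow> ('a, 'b, 'm) module_scheme \<Rightarrow> ('g \<Rightarrow> 'b set)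
    \<Rightarrow> ('a, 'c, 'n) module_scheme \<Rightarrow> ('g \<Rightarrow> 'c set) \<Rightarrow> ('b \<Rightarrow> 'c) set"
  where "graded_module_epi G R M Mg M' Mg' =
    {\<phi> \<in> graded_module_hom G R M Mg M' Mg'. \<phi> ` carrier M = carrier M'}"

end

theory Submission
  imports Defs
begin

text \<open>
  Being graded means that the homogeneous components of an element of \<open>N\<close> lie in \<open>N\<close>. A graded
  homomorphism \<open>\<phi>\<close> maps the decomposition of \<open>x\<close> to a decomposition of \<open>\<phi> x\<close>, and decompositions
  are unique. Hence, for a graded epimorphism, images and preimages of graded submodules are
  graded, and every homogeneous element of \<open>M'\<close> is the image of a homogeneous element of \<open>M\<close>
  of the same degree. Moreover the preimage of a graded prime submodule is graded prime, so \<open>\<phi>\<close> maps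
  the graded radical of \<open>N\<close> into the graded radical of \<open>\<phi> ` N\<close>.

  If now \<open>r \<odot> m' \<in> \<phi> ` N\<close> with \<open>r\<close> and \<open>m'\<close> homogeneous, lift \<open>m'\<close> to a homogeneous \<open>m\<close>. As \<open>N\<close>
  contains the kernel, membership in \<open>N\<close> can be tested after applying \<open>\<phi>\<close>, so \<open>r \<odot> m \<in> N\<close>. Both
  alternatives that the hypothesis on \<open>N\<close> offers for \<open>r\<close> and \<open>m\<close> are carried to \<open>M'\<close> by \<open>\<phi>\<close>.
\<close>

section \<open>Homogeneous decompositions\<close>

text \<open>The families are extensional, as in \<^const>\<open>internal_direct_sum\<close>, so that
  decompositions can be unique as functions.\<close>

definition decomposes ::
  "('b, 'm) ring_scheme \<Rightarrow> 'i set \<Rightarrow> ('i \<Rightarrow> 'b set) \<Rightarrow> ('i \<Rightarrow> 'b) \<Rightarrow> 'b \<Rightarrow> bool"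
  where "decomposes M I A f x \<longleftrightarrow>
    f \<in> (\<Pi>\<^sub>E i\<in>I. A i) \<and> finite {i \<in> I. f i \<noteq> \<zero>\<^bsub>M\<^esub>} \<and>
    (\<Oplus>\<^bsub>M\<^esub>i\<in>{i \<in> I. f i \<noteq> \<zero>\<^bsub>M\<^esub>}. f i) = x"

lemma internal_direct_sum_iff_decomposes:
  fixes M :: "('b, 'm) ring_scheme" and A :: "'i \<Rightarrow> 'b set"
  shows "internal_direct_sum M I A N \<longleftrightarrow>
    (\<forall>i\<in>I. additive_subgroup (A i) M) \<and>
    (\<forall>f x. decomposes M I A f x \<longrightarrow> x \<in> N) \<and>
    (\<forall>x\<in>N. \<exists>!f. decomposes M I A f x)"
proof -
  let ?F = "{f \<in> \<Pi>\<^sub>E i\<in>I. A i. finite {i \<in> I. f i \<noteq> \<zero>\<^bsub>M\<^esub>}}"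
  let ?s = "\<lambda>f. \<Oplus>\<^bsub>M\<^esub>i\<in>{i \<in> I. f i \<noteq> \<zero>\<^bsub>M\<^esub>}. f i"
  have dec: "decomposes M I A f x \<longleftrightarrow> f \<in> ?F \<and> ?s f = x" for f x
    by (auto simp: decomposes_def)
  have "bij_betw s F N \<longleftrightarrow> (\<forall>f x. f \<in> F \<and> s f = x \<longrightarrow> x \<in> N) \<and> (\<forall>x\<in>N. \<exists>!f. f \<in> F \<and> s f = x)"
    for s :: "('i \<Rightarrow> 'b) \<Rightarrow> 'b" and F
    unfolding bij_betw_def inj_on_def by blast
  then show ?thesis
    unfolding internal_direct_sum_def dec by (rule arg_cong)
qed

text \<open>For a subgroup the uniqueness of components is inherited, so only their existence inside
  \<open>N\<close> has to be checked.\<close>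

lemma internal_direct_sum_subgroupI:
  assumes M: "abelian_group M" and dec: "internal_direct_sum M I A (carrier M)"
    and N: "additive_subgroup N M"
    and ex: "\<And>x. x \<in> N \<Longrightarrow> \<exists>f. decomposes M I A f x \<and> (\<forall>i\<in>I. f i \<in> N)"
  shows "internal_direct_sum M I (\<lambda>i. N \<inter> A i) N"
proof -
  interpret abelian_group M by fact
  interpret N: additive_subgroup N M by fact
  have sub: "additive_subgroup (N \<inter> A i) M" if "i \<in> I" for i
    using that dec N.a_subgroup
    by (auto simp: internal_direct_sum_def additive_subgroup_def
        intro: add.subgroups_Inter_pair)
  have weaken: "decomposes M I A f x" if "decomposes M I (\<lambda>i. N \<inter> A i) f x" for f x
    using that by (auto simp: decomposes_def PiE_iff)
  have sum_in: "(\<Oplus>\<^bsub>M\<^esub>i\<in>S. f i) \<in> N" if "finite S" "\<And>i. i \<in> S \<Longrightarrow> f i \<in> N" for S and f :: "'c \<Rightarrow> 'a"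
    using that
  proof (induction S)
    case empty
    then show ?case by simp
  next
    case (insert i S)
    then have "f i \<in> carrier M" "f \<in> S \<rightarrow> carrier M"
      using N.a_subset by auto
    with insert show ?case by (simp add: N.a_closed)
  qed
  have "x \<in> N" if "decomposes M I (\<lambda>i. N \<inter> A i) f x" for f x
    using that sum_in[of "{i \<in> I. f i \<noteq> \<zero>\<^bsub>M\<^esub>}" f]
    by (auto simp: decomposes_def PiE_iff)
  moreover have "\<exists>!f. decomposes M I (\<lambda>i. N \<inter> A i) f x" if x: "x \<in> N" for x
  proof -
    obtain f where f: "decomposes M I A f x" "\<forall>i\<in>I. f i \<in> N"
      using ex[OF x] by blast
    then have "decomposes M I (\<lambda>i. N \<inter> A i) f x"
      by (auto simp: decomposes_def PiE_iff)
    moreover have "x \<in> carrier M" using x N.a_subset by blast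
    ultimately show ?thesis
      using dec weaken unfolding internal_direct_sum_iff_decomposes by metis
  qed
  ultimately show ?thesis
    using sub unfolding internal_direct_sum_iff_decomposes by blast
qed

lemma (in module) graded_submoduleI:
  assumes dec: "internal_direct_sum M (carrier G) Mg (carrier M)"
    and N: "submodule N R M"
    and ex: "\<And>x. x \<in> N \<Longrightarrow>
      \<exists>f. decomposes M (carrier G) Mg f x \<and> (\<forall>g\<in>carrier G. f g \<in> N)"
  shows "graded_submodule G R M Mg N"
proof -
  have "additive_subgroup N M"
    using N by (simp add: submodule_def additive_subgroup_def)
  then show ?thesis
    unfolding graded_submodule_def
    using internal_direct_sum_subgroupI[OF abelian_group_axioms dec _ ex] N by blast
qed

lemma graded_submodule_components:
  assumes "graded_submodule G R M Mg N" and "x \<in> N"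
  shows "\<exists>f. decomposes M (carrier G) Mg f x \<and> (\<forall>g\<in>carrier G. f g \<in> N)"
proof -
  obtain f where "decomposes M (carrier G) (\<lambda>g. N \<inter> Mg g) f x"
    using assms unfolding graded_submodule_def internal_direct_sum_iff_decomposes by metis
  then show ?thesis
    by (intro exI[of _ f]) (auto simp: decomposes_def PiE_iff)
qed

section \<open>Graded homomorphisms\<close>

locale graded_hom =
  M: graded_module G R Rg M Mg + M': graded_module G R Rg M' Mg'
  for G :: "('g, 'k) monoid_scheme" and R :: "('a, 'r) ring_scheme" and Rg :: "'g \<Rightarrow> 'a set"
    and M :: "('a, 'b, 'm) module_scheme" and Mg :: "'g \<Rightarrow> 'b set"
    and M' :: "('a, 'c, 'n) module_scheme" and Mg' :: "'g \<Rightarrow> 'c set" +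
  fixes \<phi> :: "'b \<Rightarrow> 'c"
  assumes graded_hom: "\<phi> \<in> graded_module_hom G R M Mg M' Mg'"
begin

sublocale group_hom "add_monoid M" "add_monoid M'" \<phi>
  using graded_hom
  by unfold_locales (simp add: graded_module_hom_def)

lemma map_closed: "x \<in> carrier M \<Longrightarrow> \<phi> x \<in> carrier M'"
  using hom_closed by simp

lemma map_zero: "\<phi> \<zero>\<^bsub>M\<^esub> = \<zero>\<^bsub>M'\<^esub>"
  using hom_one by simp

lemma map_add:
  "\<lbrakk>x \<in> carrier M; y \<in> carrier M\<rbrakk> \<Longrightarrow> \<phi> (x \<oplus>\<^bsub>M\<^esub> y) = \<phi> x \<oplus>\<^bsub>M'\<^esub> \<phi> y"
  using hom_mult by simp

lemma map_smult:
  "\<lbrakk>r \<in> carrier R; x \<in> carrier M\<rbrakk> \<Longrightarrow> \<phi> (r \<odot>\<^bsub>M\<^esub> x) = r \<odot>\<^bsub>M'\<^esub> \<phi> x"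
  using graded_hom by (simp add: graded_module_hom_def)

lemma map_degree: "\<lbrakk>g \<in> carrier G; x \<in> Mg g\<rbrakk> \<Longrightarrow> \<phi> x \<in> Mg' g"
  using graded_hom unfolding graded_module_hom_def by blast

lemma map_finsum:
  assumes "finite S" and "f \<in> S \<rightarrow> carrier M"
  shows "\<phi> (\<Oplus>\<^bsub>M\<^esub>i\<in>S. f i) = (\<Oplus>\<^bsub>M'\<^esub>i\<in>S. \<phi> (f i))"
  using assms
proof (induction S)
  case empty
  then show ?case by (simp add: map_zero)
next
  case (insert i S)
  then have "f i \<in> carrier M" "f \<in> S \<rightarrow> carrier M" "(\<lambda>i. \<phi> (f i)) \<in> S \<rightarrow> carrier M'"
    using map_closed by auto
  with insert show ?case by (simp add: map_add map_closed)
qed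

lemma component_carrier: "\<lbrakk>g \<in> carrier G; x \<in> Mg g\<rbrakk> \<Longrightarrow> x \<in> carrier M"
  using M.module_decomposition additive_subgroup.a_subset
  unfolding internal_direct_sum_def by blast

lemma decomposition_exists: "x \<in> carrier M \<Longrightarrow> \<exists>f. decomposes M (carrier G) Mg f x"
  using M.module_decomposition unfolding internal_direct_sum_iff_decomposes by blast

lemma homogeneous_scalar: "r \<in> homogeneous G Rg \<Longrightarrow> r \<in> carrier R"
  using M.ring_decomposition additive_subgroup.a_subset
  unfolding internal_direct_sum_def homogeneous_def by blast

text \<open>The support may shrink under \<open>\<phi>\<close>; the sum over the old support is still the right one
  because the lost terms vanish.\<close>

lemma map_decomposes:
  assumes f: "decomposes M (carrier G) Mg f x"
  shows "decomposes M' (carrier G) Mg' (restrict (\<phi> \<circ> f) (carrier G)) (\<phi> x)"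
proof -
  let ?h = "restrict (\<phi> \<circ> f) (carrier G)"
  let ?S = "{g \<in> carrier G. f g \<noteq> \<zero>\<^bsub>M\<^esub>}" and ?T = "{g \<in> carrier G. ?h g \<noteq> \<zero>\<^bsub>M'\<^esub>}"
  have fin: "finite ?S" and deg: "\<And>g. g \<in> carrier G \<Longrightarrow> f g \<in> Mg g"
    and x: "x = (\<Oplus>\<^bsub>M\<^esub>g\<in>?S. f g)"
    using f by (auto simp: decomposes_def)
  have carr: "f g \<in> carrier M" if "g \<in> carrier G" for g
    using component_carrier deg that by blast
  have TS: "?T \<subseteq> ?S" using map_zero by auto
  have "\<phi> x = (\<Oplus>\<^bsub>M'\<^esub>g\<in>?S. \<phi> (f g))"
    unfolding x using fin carr by (intro map_finsum) auto
  also have "\<dots> = (\<Oplus>\<^bsub>M'\<^esub>g\<in>?T. ?h g)"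
    by (rule sym, rule M'.add.finprod_mono_neutral_cong_left)
      (use fin TS carr map_closed in auto)
  finally show ?thesis
    using finite_subset[OF TS fin] deg map_degree by (auto simp: decomposes_def)
qed

text \<open>By uniqueness, any decomposition of an image is the image of the decomposition.\<close>

lemma decomposes_map_unique:
  assumes f: "decomposes M (carrier G) Mg f x" and h: "decomposes M' (carrier G) Mg' h (\<phi> x)"
    and "g \<in> carrier G"
  shows "h g = \<phi> (f g)"
proof -
  have "h = restrict (\<phi> \<circ> f) (carrier G)"
    using map_decomposes[OF f] h M'.module_decomposition
    unfolding internal_direct_sum_iff_decomposes by metis
  then show ?thesis using \<open>g \<in> carrier G\<close> by simp
qed

lemma graded_submodule_image:
  assumes N: "graded_submodule G R M Mg N"
  shows "graded_submodule G R M' Mg' (\<phi> ` N)"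
proof (rule M'.graded_submoduleI[OF M'.module_decomposition])
  have sub: "submodule N R M" using N by (simp add: graded_submodule_def)
  then have carr: "N \<subseteq> carrier M"
    by (simp add: submodule_def subgroup_def)
  have "subgroup (\<phi> ` N) (add_monoid M')"
    using sub subgroup_img_is_subgroup by (simp add: submodule_def)
  moreover have "r \<odot>\<^bsub>M'\<^esub> y \<in> \<phi> ` N" if r: "r \<in> carrier R" and y: "y \<in> \<phi> ` N" for r y
  proof -
    obtain x where x: "x \<in> N" "y = \<phi> x" using y by blast
    then have "\<phi> (r \<odot>\<^bsub>M\<^esub> x) \<in> \<phi> ` N"
      using submodule.smult_closed[OF sub r] by blast
    moreover have "x \<in> carrier M" using x(1) carr by blast
    ultimately show ?thesis using map_smult[OF r] x(2) by simp
  qed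
  ultimately show "submodule (\<phi> ` N) R M'"
    by (simp add: submodule_def submodule_axioms_def)
next
  fix y assume "y \<in> \<phi> ` N"
  then obtain x where x: "x \<in> N" "y = \<phi> x" by blast
  obtain f where "decomposes M (carrier G) Mg f x" "\<forall>g\<in>carrier G. f g \<in> N"
    using graded_submodule_components[OF N x(1)] by blast
  then show "\<exists>h. decomposes M' (carrier G) Mg' h y \<and> (\<forall>g\<in>carrier G. h g \<in> \<phi> ` N)"
    using map_decomposes x(2) by (intro exI[of _ "restrict (\<phi> \<circ> f) (carrier G)"]) auto
qed

text \<open>If \<open>\<phi> x\<close> lies in the graded submodule \<open>P\<close>, then so do its components, and these are the
  images of the components of \<open>x\<close>.\<close>

lemma graded_submodule_preimage:
  assumes P: "graded_submodule G R M' Mg' P"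
  shows "graded_submodule G R M Mg {x \<in> carrier M. \<phi> x \<in> P}" (is "graded_submodule _ _ _ _ ?Q")
proof (rule M.graded_submoduleI[OF M.module_decomposition])
  have sub: "submodule P R M'" using P by (simp add: graded_submodule_def)
  then have grp: "subgroup P (add_monoid M')" by (simp add: submodule_def)
  show "submodule ?Q R M"
  proof (rule M.submoduleI)
    show "?Q \<subseteq> carrier M" by blast
    show "\<zero>\<^bsub>M\<^esub> \<in> ?Q"
      using subgroup.one_closed[OF grp] map_zero by simp
    show "\<ominus>\<^bsub>M\<^esub> x \<in> ?Q" if "x \<in> ?Q" for x
      using that subgroup.m_inv_closed[OF grp] hom_inv[of x] by (simp add: a_inv_def[symmetric])
    show "x \<oplus>\<^bsub>M\<^esub> y \<in> ?Q" if "x \<in> ?Q" "y \<in> ?Q" for x y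
      using that subgroup.m_closed[OF grp, of "\<phi> x" "\<phi> y"] by (simp add: map_add)
    show "r \<odot>\<^bsub>M\<^esub> x \<in> ?Q" if "r \<in> carrier R" "x \<in> ?Q" for r x
      using that submodule.smult_closed[OF sub] by (simp add: map_smult)
  qed
next
  fix x assume x: "x \<in> ?Q"
  then obtain f where f: "decomposes M (carrier G) Mg f x"
    using decomposition_exists by blast
  obtain h where h: "decomposes M' (carrier G) Mg' h (\<phi> x)" "\<forall>g\<in>carrier G. h g \<in> P"
    using graded_submodule_components[OF P] x by blast
  have "f g \<in> ?Q" if "g \<in> carrier G" for g
    using decomposes_map_unique[OF f h(1) that] h(2) that component_carrier[OF that, of "f g"] f
    by (auto simp: decomposes_def)
  with f show "\<exists>f. decomposes M (carrier G) Mg f x \<and> (\<forall>g\<in>carrier G. f g \<in> ?Q)"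
    by blast
qed

lemma preimage_image_if_kernel_subset:
  assumes N: "submodule N R M" and ker: "a_kernel M M' \<phi> \<subseteq> N"
    and x: "x \<in> carrier M" and im: "\<phi> x \<in> \<phi> ` N"
  shows "x \<in> N"
proof -
  have grp: "subgroup N (add_monoid M)" using N by (simp add: submodule_def)
  obtain n where n: "n \<in> N" "\<phi> x = \<phi> n" using im by blast
  have nc: "n \<in> carrier M" using subgroup.subset[OF grp] n(1) by auto
  define d where "d = x \<ominus>\<^bsub>M\<^esub> n"
  have dc: "d \<in> carrier M" unfolding d_def using x nc by simp
  have xd: "x = d \<oplus>\<^bsub>M\<^esub> n"
    unfolding d_def using x nc by (simp add: a_minus_def M.a_assoc M.l_neg)
  then have "\<phi> n = \<phi> d \<oplus>\<^bsub>M'\<^esub> \<phi> n"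
    using map_add[OF dc nc] n(2) by simp
  then have "\<phi> d = \<zero>\<^bsub>M'\<^esub>"
    using map_closed[OF dc] map_closed[OF nc] by simp
  then have "d \<in> N" using ker dc by (auto simp: a_kernel_def kernel_def)
  then show ?thesis
    using xd subgroup.m_closed[OF grp _ n(1)] by simp
qed

end

section \<open>Graded epimorphisms\<close>

locale graded_epi = graded_hom +
  assumes surj: "\<phi> ` carrier M = carrier M'"
begin

text \<open>For \<open>y\<close> of degree \<open>g\<close>, the component of degree \<open>g\<close> of any preimage of \<open>y\<close> is a lift:
  the images of the components of the preimage are the components of \<open>y\<close>.\<close>

lemma homogeneous_lift:
  assumes y: "y \<in> homogeneous G Mg'"
  obtains x where "x \<in> homogeneous G Mg" and "\<phi> x = y"
proof -
  obtain g where g: "g \<in> carrier G" "y \<in> Mg' g"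
    using y by (auto simp: homogeneous_def)
  have sg: "additive_subgroup (Mg' i) M'" if "i \<in> carrier G" for i
    using M'.module_decomposition that by (simp add: internal_direct_sum_def)
  have yc: "y \<in> carrier M'"
    using additive_subgroup.a_subset[OF sg[OF g(1)]] g(2) by blast
  then have "y \<in> \<phi> ` carrier M" using surj by simp
  then obtain x where x: "x \<in> carrier M" "\<phi> x = y" by blast
  then obtain f where f: "decomposes M (carrier G) Mg f x"
    using decomposition_exists by blast
  \<comment> \<open>The homogeneous element \<open>y\<close> is its own component of degree \<open>g\<close>.\<close>
  define h where "h = (\<lambda>i\<in>carrier G. if i = g then y else \<zero>\<^bsub>M'\<^esub>)"
  have "decomposes M' (carrier G) Mg' h y"
  proof (cases "y = \<zero>\<^bsub>M'\<^esub>")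
    case True
    then have "{i \<in> carrier G. h i \<noteq> \<zero>\<^bsub>M'\<^esub>} = {}" by (auto simp: h_def)
    then show ?thesis
      using True additive_subgroup.zero_closed[OF sg] by (auto simp: decomposes_def h_def)
  next
    case False
    then have supp: "{i \<in> carrier G. h i \<noteq> \<zero>\<^bsub>M'\<^esub>} = {g}" using g(1) by (auto simp: h_def)
    have hg: "h g = y" using g(1) by (simp add: h_def)
    have "h \<in> (\<Pi>\<^sub>E i\<in>carrier G. Mg' i)"
      using g additive_subgroup.zero_closed[OF sg] by (auto simp: h_def)
    then show ?thesis
      unfolding decomposes_def supp using yc hg by simp
  qed
  then have "h g = \<phi> (f g)"
    using decomposes_map_unique[OF f] x(2) g(1) by blast
  moreover have "f g \<in> homogeneous G Mg"
    using f g(1) by (auto simp: decomposes_def homogeneous_def)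
  ultimately show ?thesis
    using that g(1) by (simp add: h_def)
qed

text \<open>Surjectivity is what keeps the preimage proper; the prime condition pulls back because \<open>\<phi>\<close>
  is linear and preserves degrees.\<close>

lemma graded_prime_submodule_preimage:
  assumes P: "graded_prime_submodule G R Rg M' Mg' P"
  shows "graded_prime_submodule G R Rg M Mg {x \<in> carrier M. \<phi> x \<in> P}"
    (is "graded_prime_submodule _ _ _ _ _ ?Q")
  unfolding graded_prime_submodule_def
proof (intro conjI ballI impI)
  have gr: "graded_submodule G R M' Mg' P" and proper: "P \<noteq> carrier M'"
    and prime: "\<And>r m. \<lbrakk>r \<in> homogeneous G Rg; m \<in> homogeneous G Mg'; r \<odot>\<^bsub>M'\<^esub> m \<in> P\<rbrakk>
      \<Longrightarrow> r \<in> residual R M' P \<or> m \<in> P"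
    using P by (auto simp: graded_prime_submodule_def)
  show "graded_submodule G R M Mg ?Q" by (rule graded_submodule_preimage[OF gr])
  have "P \<subseteq> carrier M'"
    using gr by (simp add: graded_submodule_def submodule_def subgroup_def)
  with proper obtain y where y: "y \<in> carrier M'" "y \<notin> P" by blast
  then obtain x where "x \<in> carrier M" "y = \<phi> x" unfolding surj[symmetric] by blast
  with y(2) show "?Q \<noteq> carrier M" by blast
  fix r m assume r: "r \<in> homogeneous G Rg" and m: "m \<in> homogeneous G Mg" and rm: "r \<odot>\<^bsub>M\<^esub> m \<in> ?Q"
  have rc: "r \<in> carrier R" using homogeneous_scalar r .
  have mc: "m \<in> carrier M" using m component_carrier by (auto simp: homogeneous_def)
  have "\<phi> m \<in> homogeneous G Mg'" using m map_degree by (auto simp: homogeneous_def)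
  moreover have "r \<odot>\<^bsub>M'\<^esub> \<phi> m \<in> P" using rm map_smult[OF rc mc] by simp
  ultimately consider "r \<in> residual R M' P" | "\<phi> m \<in> P" using prime r by blast
  then show "r \<in> residual R M ?Q \<or> m \<in> ?Q"
  proof cases
    case 1
    then show ?thesis using rc by (auto simp: residual_def map_smult map_closed)
  next
    case 2
    then show ?thesis using mc by simp
  qed
qed

text \<open>Every graded prime submodule over \<open>\<phi> ` N\<close> pulls back to one over \<open>N\<close>, which contains \<open>m\<close>.
  In particular, if there is none over \<open>N\<close>, there is none over \<open>\<phi> ` N\<close>, and the radical of the
  image is all of \<open>M'\<close>.\<close>

lemma graded_radical_image:
  assumes N: "N \<subseteq> carrier M" and m: "m \<in> carrier M" and rad: "m \<in> graded_radical G R Rg M Mg N"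
  shows "\<phi> m \<in> graded_radical G R Rg M' Mg' (\<phi> ` N)"
proof -
  have "\<phi> m \<in> P" if P: "graded_prime_submodule G R Rg M' Mg' P" "\<phi> ` N \<subseteq> P" for P
  proof -
    have "N \<subseteq> {x \<in> carrier M. \<phi> x \<in> P}" using N P(2) by blast
    then have "m \<in> {x \<in> carrier M. \<phi> x \<in> P}"
      using rad graded_prime_submodule_preimage[OF P(1)]
      unfolding graded_radical_def by (auto split: if_splits)
    then show ?thesis by simp
  qed
  then show ?thesis using map_closed[OF m] by (auto simp: graded_radical_def)
qed

lemma residual_image:
  assumes "r \<in> residual R M N"
  shows "r \<in> residual R M' (\<phi> ` N)"
  unfolding residual_def
proof (intro CollectI conjI ballI)
  show r: "r \<in> carrier R" using assms by (simp add: residual_def)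
  fix y assume "y \<in> carrier M'"
  then obtain x where x: "x \<in> carrier M" "y = \<phi> x" unfolding surj[symmetric] by blast
  then have "r \<odot>\<^bsub>M\<^esub> x \<in> N" using assms by (simp add: residual_def)
  then have "\<phi> (r \<odot>\<^bsub>M\<^esub> x) \<in> \<phi> ` N" by (rule imageI)
  then show "r \<odot>\<^bsub>M'\<^esub> y \<in> \<phi> ` N" using map_smult[OF r x(1)] x(2) by simp
qed

end

theorem theorem4p11:
  fixes G :: "('g, 'k) monoid_scheme"
    and R :: "('a, 'r) ring_scheme" and Rg :: "'g \<Rightarrow> 'a set"
    and M :: "('a, 'b, 'm) module_scheme" and Mg :: "'g \<Rightarrow> 'b set"
    and M' :: "('a, 'c, 'n) module_scheme" and Mg' :: "'g \<Rightarrow> 'c set"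
    and \<phi> :: "'b \<Rightarrow> 'c" and N :: "'b set"
  assumes "graded_module G R Rg M Mg"
    and "graded_module G R Rg M' Mg'"
    and "\<phi> \<in> graded_module_epi G R M Mg M' Mg'"
    and "graded_submodule G R M Mg N"
    and "a_kernel M M' \<phi> \<subseteq> N"
    and "graded_primary_like_submodule G R Rg M Mg N"
  shows "graded_primary_like_submodule G R Rg M' Mg' (\<phi> ` N)"
proof -
  interpret M: graded_module G R Rg M Mg by fact
  interpret M': graded_module G R Rg M' Mg' by fact
  interpret graded_epi G R Rg M Mg M' Mg' \<phi>
    using assms(3) by unfold_locales (auto simp: graded_module_epi_def)
  have sub: "submodule N R M" using assms(4) by (simp add: graded_submodule_def)
  have Nc: "N \<subseteq> carrier M" using sub by (simp add: submodule_def subgroup_def)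
  note lift = preimage_image_if_kernel_subset[OF sub assms(5)]
  have proper: "N \<noteq> carrier M"
    and primary: "\<And>r m. \<lbrakk>r \<in> homogeneous G Rg; m \<in> homogeneous G Mg; r \<odot>\<^bsub>M\<^esub> m \<in> N\<rbrakk>
      \<Longrightarrow> r \<in> residual R M N \<or> m \<in> graded_radical G R Rg M Mg N"
    using assms(6) by (auto simp: graded_primary_like_submodule_def)
  show ?thesis
    unfolding graded_primary_like_submodule_def
  proof (intro conjI ballI impI)
    show "graded_submodule G R M' Mg' (\<phi> ` N)" by (rule graded_submodule_image[OF assms(4)])
    show "\<phi> ` N \<noteq> carrier M'"
    proof -
      obtain x where x: "x \<in> carrier M" "x \<notin> N" using proper Nc by blast
      then have "\<phi> x \<notin> \<phi> ` N" using lift by blast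
      then show ?thesis using map_closed[OF x(1)] by blast
    qed
    fix r m' assume r: "r \<in> homogeneous G Rg" and m': "m' \<in> homogeneous G Mg'"
      and rm': "r \<odot>\<^bsub>M'\<^esub> m' \<in> \<phi> ` N"
    obtain m where m: "m \<in> homogeneous G Mg" and m'_eq: "\<phi> m = m'"
      using homogeneous_lift[OF m'] .
    have rc: "r \<in> carrier R" using homogeneous_scalar r .
    have mc: "m \<in> carrier M" using m component_carrier by (auto simp: homogeneous_def)
    have "r \<odot>\<^bsub>M\<^esub> m \<in> N"
      using lift[of "r \<odot>\<^bsub>M\<^esub> m"] rm' map_smult[OF rc mc] m'_eq rc mc by simp
    then show "r \<in> residual R M' (\<phi> ` N) \<or> m' \<in> graded_radical G R Rg M' Mg' (\<phi> ` N)"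
      using primary[OF r m] residual_image graded_radical_image[OF Nc mc] m'_eq by blast
  qed
qed

end
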